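(* Let $R$ be a ring. Then $R$ is uniquely $\pi$-clean if and only if both of the following hold: (1) $R$ is abelian. (2) For any $a\in R$, there exists an $n\in\mathbb{N}$ for which there is a unique idempotent $e\in a^nR$ such that $1-e\in(1-a^n)R$.
   Context: All rings are associative with identity, not necessarily commutative. $\mathbb{N}$ denotes the positive integers. A ring is abelian if every idempotent in it is central. An element $x$ of a ring $R$ is uniquely clean if it can be written in exactly one way as $x=e+u$ with $e\in R$ an idempotent and $u\in R$ a unit. A ring $R$ is uniquely $\pi$-clean if for every $a\in R$ there exists $n\in\mathbb{N}$ such that $a^n$ is uniquely clean. *)

theory Defs
  imports "HOL-Algebra.Algebra"
begin

text \<open>
  Rings are those of the locale \<open>ring\<close>: associative, with identity, not necessarily
  commutative; the zero ring is included.
\<close>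

definition idempotents :: "('a, 'm) ring_scheme \<Rightarrow> 'a set" where
  "idempotents R = {e \<in> carrier R. e \<otimes>\<^bsub>R\<^esub> e = e}"

definition abelian_ring :: "('a, 'm) ring_scheme \<Rightarrow> bool" where
  "abelian_ring R \<longleftrightarrow>
     (\<forall>e \<in> idempotents R. \<forall>x \<in> carrier R. e \<otimes>\<^bsub>R\<^esub> x = x \<otimes>\<^bsub>R\<^esub> e)"

text \<open>Uniqueness concerns the pair \<open>(e, u)\<close>, i.e. the decomposition itself.\<close>

definition uniquely_clean :: "('a, 'm) ring_scheme \<Rightarrow> 'a \<Rightarrow> bool" where
  "uniquely_clean R x \<longleftrightarrow>
     (\<exists>!p. p \<in> idempotents R \<times> Units R \<and> x = fst p \<oplus>\<^bsub>R\<^esub> snd p)"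

definition uniquely_pi_clean :: "('a, 'm) ring_scheme \<Rightarrow> bool" where
  "uniquely_pi_clean R \<longleftrightarrow>
     (\<forall>a \<in> carrier R. \<exists>n::nat. n \<ge> 1 \<and> uniquely_clean R (a [^]\<^bsub>R\<^esub> n))"

text \<open>
  The right ideal \<open>aR\<close>. (The library's \<open>genideal\<close> is two-sided, and its \<open>cgenideal\<close> is
  the left ideal \<open>Ra\<close>.)
\<close>

definition principal_right_ideal :: "('a, 'm) ring_scheme \<Rightarrow> 'a \<Rightarrow> 'a set" where
  "principal_right_ideal R a = {a \<otimes>\<^bsub>R\<^esub> r | r. r \<in> carrier R}"

end

theory Submission
  imports Defs
begin

text \<open>
  In an abelian ring \<open>e \<mapsto> 1 - e\<close> is a bijection between the idempotents \<open>e \<in> xR\<close> with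
  \<open>1 - e \<in> (1 - x)R\<close> and the idempotents \<open>f\<close> with \<open>x - f\<close> a unit: if \<open>e = xr\<close> and
  \<open>1 - e = (1 - x)s\<close>, then \<open>er - (1 - e)s\<close> is a right inverse of \<open>x - (1 - e)\<close>, and one-sided
  inverses in an abelian ring are two-sided. That uniquely \<open>\<pi>\<close>-clean rings are abelian holds
  because every idempotent \<open>e\<close> equals its powers, hence is uniquely clean, while for
  \<open>t = er(1 - e)\<close> the element \<open>1 - e + t\<close> is idempotent and \<open>2e - 1 - t\<close> squares to \<open>1\<close>,
  so \<open>t = 0\<close>.
\<close>

lemma abelian_ringD:
  "abelian_ring R \<Longrightarrow> e \<in> idempotents R \<Longrightarrow> x \<in> carrier R \<Longrightarrow> e \<otimes>\<^bsub>R\<^esub> x = x \<otimes>\<^bsub>R\<^esub> e"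
  unfolding abelian_ring_def by blast

lemma principal_right_idealI:
  "r \<in> carrier R \<Longrightarrow> e = a \<otimes>\<^bsub>R\<^esub> r \<Longrightarrow> e \<in> principal_right_ideal R a"
  unfolding principal_right_ideal_def by blast

context ring
begin

lemma idempotents_closed: "e \<in> idempotents R \<Longrightarrow> e \<in> carrier R"
  by (simp add: idempotents_def)

lemma idempotents_square: "e \<in> idempotents R \<Longrightarrow> e \<otimes> e = e"
  by (simp add: idempotents_def)

lemma idempotents_mult_compl:
  assumes "e \<in> idempotents R"
  shows "e \<otimes> (\<one> \<ominus> e) = \<zero>" and "(\<one> \<ominus> e) \<otimes> e = \<zero>"
  using assms by (simp_all add: idempotents_def minus_eq r_distr l_distr r_minus l_minus r_neg)

lemma idempotents_compl:
  assumes "e \<in> idempotents R"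
  shows "\<one> \<ominus> e \<in> idempotents R"
proof -
  have e: "e \<in> carrier R" using assms by (rule idempotents_closed)
  have "(\<one> \<ominus> e) \<otimes> (\<one> \<ominus> e) = (\<one> \<ominus> e) \<ominus> e \<otimes> (\<one> \<ominus> e)"
    using e by (simp add: minus_eq l_distr l_minus)
  also have "\<dots> = \<one> \<ominus> e"
    using e idempotents_mult_compl[OF assms] by (simp add: minus_eq)
  finally show ?thesis using e by (simp add: idempotents_def)
qed

lemma add_compl: "e \<in> carrier R \<Longrightarrow> e \<oplus> (\<one> \<ominus> e) = \<one>"
  by (simp add: minus_eq a_lcomm[of e \<one>] r_neg)

lemma compl_compl: "e \<in> carrier R \<Longrightarrow> \<one> \<ominus> (\<one> \<ominus> e) = e"
  by (simp add: minus_eq minus_add a_assoc[symmetric] r_neg)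

text \<open>The unit in a decomposition is forced to be \<open>x \<ominus> e\<close>, so only the
  idempotent is left to be unique.\<close>

lemma uniquely_clean_iff:
  assumes x: "x \<in> carrier R"
  shows "uniquely_clean R x \<longleftrightarrow> (\<exists>!e. e \<in> idempotents R \<and> x \<ominus> e \<in> Units R)"
proof -
  have *: "p \<in> idempotents R \<times> Units R \<and> x = fst p \<oplus> snd p \<longleftrightarrow>
      fst p \<in> idempotents R \<and> x \<ominus> fst p \<in> Units R \<and> snd p = x \<ominus> fst p" for p
  proof -
    have "x = fst p \<oplus> snd p \<longleftrightarrow> snd p = x \<ominus> fst p"
      if "fst p \<in> carrier R" "snd p \<in> carrier R"
      using that x by (metis a_comm add.inv_solve_right minus_eq)
    moreover have "x \<ominus> fst p \<in> Units R \<Longrightarrow> snd p = x \<ominus> fst p \<Longrightarrow> snd p \<in> carrier R"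
      by (simp add: Units_closed)
    ultimately show ?thesis
      by (auto simp: mem_Times_iff Units_closed idempotents_closed)
  qed
  show ?thesis
    unfolding uniquely_clean_def * by (auto simp: Ex1_def prod_eq_iff)
qed

lemma idempotent_pow:
  assumes "e \<in> idempotents R" and "(n::nat) \<ge> 1"
  shows "e [^] n = e"
  using assms(2)
proof (induction n rule: dec_induct)
  case base
  show ?case using assms(1) by (simp add: idempotents_closed)
next
  case (step n)
  then show ?case using assms(1) by (simp add: idempotents_square)
qed

text \<open>The two corners off the diagonal of the Peirce decomposition measure how far
  \<open>e\<close> is from being central. This removes one of them; the other is the same corner for
  the complement of \<open>e\<close>.\<close>

lemma uniquely_clean_idempotent_corner:
  assumes e: "e \<in> idempotents R" and uc: "uniquely_clean R e" and r: "r \<in> carrier R"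
  shows "e \<otimes> r \<otimes> (\<one> \<ominus> e) = \<zero>"
proof -
  define f where "f = \<one> \<ominus> e"
  define t where "t = e \<otimes> r \<otimes> f"
  have f: "f \<in> idempotents R" unfolding f_def by (rule idempotents_compl[OF e])
  have [simp]: "e \<in> carrier R" "f \<in> carrier R" "t \<in> carrier R"
    using e f r by (auto simp: t_def idempotents_closed)
  have ef: "e \<otimes> f = \<zero>" "f \<otimes> e = \<zero>"
    unfolding f_def by (rule idempotents_mult_compl[OF e])+
  have ee: "e \<otimes> e = e" and ff: "f \<otimes> f = f"
    using e f by (simp_all add: idempotents_square)
  have et: "e \<otimes> t = t"
    unfolding t_def using r by (simp add: m_assoc[symmetric] ee)
  have ft: "f \<otimes> t = \<zero>"
    unfolding t_def using r by (simp add: m_assoc[symmetric] ef)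
  have te: "t \<otimes> e = \<zero>"
    unfolding t_def using r by (simp add: m_assoc ef)
  have tf: "t \<otimes> f = t"
    unfolding t_def using r by (simp add: m_assoc ff)
  \<comment> \<open>Insert \<open>e\<close> between the factors:
    \<open>t t = t (e t) = (t e) t = 0\<close>.\<close>
  have tt: "t \<otimes> t = \<zero>"
    using ft te by (metis \<open>e \<in> carrier R\<close> \<open>t \<in> carrier R\<close> et m_assoc l_null)
  have one: "\<one> = e \<oplus> f"
    by (simp add: f_def add_compl)
  \<comment> \<open>Stated for a general \<open>s\<close> because it is used for both
    \<open>t\<close> and \<open>0\<close>, giving two decompositions of \<open>e\<close>. In the
    square of \<open>e - f - s\<close> the cross terms \<open>- e s\<close> and \<open>s f\<close>
    cancel, leaving \<open>e + f = 1\<close>, so this element is its own inverse.\<close>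
  have gen: "f \<oplus> s \<in> idempotents R \<and> e \<ominus> (f \<oplus> s) \<in> Units R"
    if s: "s \<in> carrier R" "e \<otimes> s = s" "f \<otimes> s = \<zero>" "s \<otimes> e = \<zero>" "s \<otimes> f = s" "s \<otimes> s = \<zero>" for s
  proof -
    have "(f \<oplus> s) \<otimes> (f \<oplus> s) = f \<oplus> s"
      using s by (simp add: l_distr r_distr ff)
    moreover have "(e \<ominus> (f \<oplus> s)) \<otimes> (e \<ominus> (f \<oplus> s)) = \<one>"
      using s by (simp add: one minus_eq minus_add l_distr r_distr l_minus r_minus
          ee ef ff a_ac r_neg r_neg1 r_neg2)
    ultimately show ?thesis
      using s by (auto simp: idempotents_def Units_def)
  qed
  have "f \<oplus> t \<in> idempotents R \<and> e \<ominus> (f \<oplus> t) \<in> Units R"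
    using et ft te tf tt by (intro gen) simp_all
  moreover have "f \<oplus> \<zero> \<in> idempotents R \<and> e \<ominus> (f \<oplus> \<zero>) \<in> Units R"
    by (intro gen) simp_all
  ultimately have "f \<oplus> t = f \<oplus> \<zero>"
    using uc unfolding uniquely_clean_iff[OF \<open>e \<in> carrier R\<close>] by blast
  then show ?thesis
    unfolding t_def[symmetric, unfolded f_def] by (simp add: add.l_cancel)
qed

lemma uniquely_pi_clean_imp_abelian:
  assumes "uniquely_pi_clean R"
  shows "abelian_ring R"
  unfolding abelian_ring_def
proof (intro ballI)
  have corner: "e \<otimes> r \<otimes> (\<one> \<ominus> e) = \<zero>" if "e \<in> idempotents R" "r \<in> carrier R" for e r
  proof -
    from assms that(1) obtain n :: nat where "n \<ge> 1" "uniquely_clean R (e [^] n)"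
      unfolding uniquely_pi_clean_def using idempotents_closed by blast
    then show ?thesis
      using that idempotent_pow uniquely_clean_idempotent_corner by metis
  qed
  fix e r
  assume e: "e \<in> idempotents R" and r: "r \<in> carrier R"
  have ec: "e \<in> carrier R" using e by (rule idempotents_closed)
  have "e \<otimes> r \<ominus> e \<otimes> r \<otimes> e = \<zero>"
    using corner[OF e r] ec r by (simp add: minus_eq r_distr r_minus)
  \<comment> \<open>The corner of the complement: \<open>(1 - e) r e = 0\<close>. Both
    \<open>e r\<close> and \<open>r e\<close> thus equal \<open>e r e\<close>.\<close>
  moreover have "r \<otimes> e \<ominus> e \<otimes> r \<otimes> e = \<zero>"
    using corner[OF idempotents_compl[OF e] r] ec r
    by (simp only: compl_compl[OF ec]) (simp add: minus_eq l_distr l_minus)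
  ultimately show "e \<otimes> r = r \<otimes> e"
    using ec r by (metis m_closed r_right_minus_eq)
qed

text \<open>The idempotent \<open>b a\<close> is central, so
  \<open>b a = (b a) a b = a (b a) b = (a b)(a b) = 1\<close>.\<close>

lemma abelian_right_inverse_Units:
  assumes ab: "abelian_ring R" and a: "a \<in> carrier R" and b: "b \<in> carrier R"
    and inv: "a \<otimes> b = \<one>"
  shows "a \<in> Units R"
proof -
  have "b \<otimes> a \<otimes> (b \<otimes> a) = b \<otimes> (a \<otimes> b) \<otimes> a"
    using a b by (simp add: m_assoc)
  then have "b \<otimes> a \<in> idempotents R"
    using a b inv by (simp add: idempotents_def)
  then have central: "b \<otimes> a \<otimes> a = a \<otimes> (b \<otimes> a)"
    using ab a by (intro abelian_ringD)
  have "b \<otimes> a = b \<otimes> a \<otimes> a \<otimes> b"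
    using a b inv by (simp add: m_assoc)
  also have "\<dots> = (a \<otimes> b) \<otimes> (a \<otimes> b)"
    using a b by (simp add: central m_assoc)
  finally have "b \<otimes> a = \<one>" using inv by simp
  then show ?thesis using a b inv by (auto simp: Units_def)
qed

text \<open>Write \<open>f = 1 - e\<close>. Since \<open>e\<close> and \<open>f\<close> are central
  and orthogonal, \<open>x - f\<close> acts as \<open>x\<close> on \<open>eR\<close> and as
  \<open>x - 1\<close> on \<open>fR\<close>. The two memberships say that each of these parts has a
  right inverse.\<close>

lemma abelian_minus_compl_Units_iff:
  assumes ab: "abelian_ring R" and x: "x \<in> carrier R" and e: "e \<in> idempotents R"
  shows "x \<ominus> (\<one> \<ominus> e) \<in> Units R \<longleftrightarrow>
    e \<in> principal_right_ideal R x \<and> \<one> \<ominus> e \<in> principal_right_ideal R (\<one> \<ominus> x)"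
proof -
  define f where "f = \<one> \<ominus> e"
  have f: "f \<in> idempotents R" unfolding f_def by (rule idempotents_compl[OF e])
  have [simp]: "e \<in> carrier R" "f \<in> carrier R" "x \<in> carrier R"
    using e f x by (auto simp: idempotents_closed)
  have ef: "e \<otimes> f = \<zero>" "f \<otimes> e = \<zero>"
    unfolding f_def by (rule idempotents_mult_compl[OF e])+
  have ee: "e \<otimes> e = e" and ff: "f \<otimes> f = f"
    using e f by (simp_all add: idempotents_square)
  have xe: "x \<otimes> e = e \<otimes> x"
    using abelian_ringD[OF ab e x] by (rule sym)
  have xf: "x \<otimes> f = f \<otimes> x"
    using abelian_ringD[OF ab f x] by (rule sym)
  have one: "\<one> = e \<oplus> f"
    by (simp add: f_def add_compl)
  have "x \<ominus> f \<in> Units R \<longleftrightarrow>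
    e \<in> principal_right_ideal R x \<and> f \<in> principal_right_ideal R (\<one> \<ominus> x)"
  proof (intro iffI conjI; (elim conjE)?)
    assume u: "x \<ominus> f \<in> Units R"
    define v where "v = inv (x \<ominus> f)"
    have v: "v \<in> carrier R" "(x \<ominus> f) \<otimes> v = \<one>"
      using u by (simp_all add: v_def)
    \<comment> \<open>Multiplication by \<open>e\<close> kills \<open>f\<close>, so
      \<open>e (x - f) = x e\<close>.\<close>
    have "x \<otimes> (e \<otimes> v) = e \<otimes> ((x \<ominus> f) \<otimes> v)"
      using v(1) by (simp add: m_assoc[symmetric] xe minus_eq r_distr r_minus ef)
    then show "e \<in> principal_right_ideal R x"
      using v by (intro principal_right_idealI[of "e \<otimes> v"]) simp_all
    \<comment> \<open>On the other part \<open>f (x - f) = (x - 1) f\<close>; the sign of the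
      witness turns \<open>x - 1\<close> into \<open>1 - x\<close>.\<close>
    have "(\<one> \<ominus> x) \<otimes> (\<ominus> (f \<otimes> v)) = ((x \<ominus> \<one>) \<otimes> f) \<otimes> v"
      using v(1) by (simp add: minus_eq m_assoc l_distr l_minus r_minus minus_add a_comm)
    also have "\<dots> = f \<otimes> ((x \<ominus> f) \<otimes> v)"
      using v(1) by (simp add: m_assoc[symmetric] xf minus_eq l_distr r_distr l_minus r_minus ff)
    finally show "f \<in> principal_right_ideal R (\<one> \<ominus> x)"
      using v by (intro principal_right_idealI[of "\<ominus> (f \<otimes> v)"]) simp_all
  next
    assume "e \<in> principal_right_ideal R x" "f \<in> principal_right_ideal R (\<one> \<ominus> x)"
    then obtain r s where r: "r \<in> carrier R" "e = x \<otimes> r"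
      and s: "s \<in> carrier R" "f = (\<one> \<ominus> x) \<otimes> s"
      unfolding principal_right_ideal_def by blast
    have "(x \<ominus> f) \<otimes> (e \<otimes> r) = e \<otimes> (x \<otimes> r)"
      using r(1) by (simp add: m_assoc[symmetric] minus_eq l_distr l_minus xe ef)
    then have 1: "(x \<ominus> f) \<otimes> (e \<otimes> r) = e"
      by (simp flip: r(2) add: ee)
    have "(x \<ominus> f) \<otimes> f = \<ominus> (f \<otimes> (\<one> \<ominus> x))"
      by (simp add: minus_eq l_distr r_distr l_minus r_minus xf ff minus_add a_comm)
    then have "(x \<ominus> f) \<otimes> (f \<otimes> s) = \<ominus> (f \<otimes> ((\<one> \<ominus> x) \<otimes> s))"
      using s(1) by (simp add: m_assoc[symmetric] l_minus)
    then have 2: "(x \<ominus> f) \<otimes> (f \<otimes> s) = \<ominus> f"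
      by (simp flip: s(2) add: ff)
    \<comment> \<open>Subtracting the two partial inverses yields \<open>e + f = 1\<close>. This is
      only a right inverse, hence the appeal to \<open>abelian_right_inverse_Units\<close>
      below.\<close>
    have "(x \<ominus> f) \<otimes> (e \<otimes> r \<ominus> f \<otimes> s) = (x \<ominus> f) \<otimes> (e \<otimes> r) \<ominus> (x \<ominus> f) \<otimes> (f \<otimes> s)"
      using r(1) s(1) by (simp add: minus_eq[of "e \<otimes> r"] minus_eq[of "_ \<otimes> (e \<otimes> r)"] r_distr r_minus)
    also have "\<dots> = \<one>" unfolding 1 2 by (simp add: one minus_eq)
    finally show "x \<ominus> f \<in> Units R"
      using r(1) s(1) by (intro abelian_right_inverse_Units[OF ab]) auto
  qed
  then show ?thesis by (simp add: f_def)
qed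

lemma abelian_uniquely_clean_iff:
  assumes ab: "abelian_ring R" and x: "x \<in> carrier R"
  shows "uniquely_clean R x \<longleftrightarrow>
    (\<exists>!e. e \<in> idempotents R \<and> e \<in> principal_right_ideal R x \<and>
      \<one> \<ominus> e \<in> principal_right_ideal R (\<one> \<ominus> x))"
proof -
  have "uniquely_clean R x \<longleftrightarrow> (\<exists>!e. e \<in> idempotents R \<and> x \<ominus> e \<in> Units R)"
    by (rule uniquely_clean_iff[OF x])
  \<comment> \<open>The involution \<open>e \<mapsto> 1 - e\<close> permutes the idempotents, so
    unique existence carries over.\<close>
  also have "\<dots> \<longleftrightarrow> (\<exists>!e. e \<in> idempotents R \<and> x \<ominus> (\<one> \<ominus> e) \<in> Units R)"
    by (smt (verit, ccfv_threshold) compl_compl idempotents_closed idempotents_compl)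
  also have "\<dots> \<longleftrightarrow> (\<exists>!e. e \<in> idempotents R \<and> e \<in> principal_right_ideal R x \<and>
      \<one> \<ominus> e \<in> principal_right_ideal R (\<one> \<ominus> x))"
    using abelian_minus_compl_Units_iff[OF ab x] by (simp cong: conj_cong)
  finally show ?thesis .
qed

end

theorem theorem2p4:
  fixes R :: "('a, 'm) ring_scheme"
  assumes "ring R"
  shows "uniquely_pi_clean R \<longleftrightarrow>
    abelian_ring R \<and>
    (\<forall>a \<in> carrier R. \<exists>n::nat. n \<ge> 1 \<and>
      (\<exists>!e. e \<in> idempotents R \<and>
            e \<in> principal_right_ideal R (a [^]\<^bsub>R\<^esub> n) \<and>
            \<one>\<^bsub>R\<^esub> \<ominus>\<^bsub>R\<^esub> e \<in> principal_right_ideal R (\<one>\<^bsub>R\<^esub> \<ominus>\<^bsub>R\<^esub> (a [^]\<^bsub>R\<^esub> n))))"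
proof -
  interpret ring R by (rule assms)
  show ?thesis
  \<comment> \<open>In the abelian case the two conditions agree for each power of \<open>a\<close>
    separately, with the same \<open>n\<close>; otherwise both sides fail.\<close>
  proof (cases "abelian_ring R")
    case True
    then show ?thesis
      by (simp add: uniquely_pi_clean_def abelian_uniquely_clean_iff)
  next
    case False
    then show ?thesis using uniquely_pi_clean_imp_abelian by blast
  qed
qed

end
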